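(* Let $\|\cdot\|$ be a $C^2$ and strictly convex norm on $\mathbb{R}^2$. There exists a constant $C>0$ depending only on $\|\cdot\|$ such that for every interval $I\subset\mathbb{R}$ and every $\|\cdot\|$-self-contracted curve $\gamma:I\to\mathbb{R}^2$, $$\ell(\gamma)\leq C\,\mathrm{diam}(K(\gamma)),$$ where $\ell(\gamma)$ is the length of $\gamma$, $K(\gamma)$ is the closed convex hull of the image $\gamma(I)$, and $\mathrm{diam}$ is the diameter. In particular, every bounded $\|\cdot\|$-self-contracted curve has finite length.
   Context: $|\cdot|$ denotes the Euclidean norm on $\mathbb{R}^2$; lengths and diameters are computed with it (all norms on $\mathbb{R}^2$ being equivalent, this only affects the constant). A curve is any map $\gamma:I\to\mathbb{R}^2$ from an interval $I\subset\mathbb{R}$, not necessarily continuous. Its length is $\ell(\gamma)=\sup\sum_{i=0}^{m-1}|\gamma(t_i)-\gamma(t_{i+1})|$, the supremum over all finite increasing sequences $t_0<t_1<\dots<t_m$ in $I$. A curve $\gamma:I\to\mathbb{R}^2$ is $\|\cdot\|$-self-contracted if for every $[a,b]\subset I$ the function $t\mapsto\|\gamma(t)-\gamma(b)\|$ is non-increasing on $[a,b]$. The norm is called $C^2$ if $x\mapsto\|x\|$ is $C^2$ on $\mathbb{R}^2\setminus\{0\}$, and $C^2$ and strictly convex if moreover the unit sphere $\{\|x\|=1\}$ is a $C^2$ curve with strictly positive curvature (equivalently $D^2\|x\|(h,h)>0$ for all $x\neq0$ and all $h$ not parallel to $x$); in particular the unit ball is strictly convex (its boundary contains no nontrivial segment).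 *)

theory Defs
  imports "HOL-Analysis.Analysis"
begin

definition is_norm :: "(real^2 \<Rightarrow> real) \<Rightarrow> bool" where
  "is_norm N \<longleftrightarrow> (\<forall>x. N x = 0 \<longleftrightarrow> x = 0) \<and> (\<forall>c x. N (c *\<^sub>R x) = \<bar>c\<bar> * N x)
      \<and> (\<forall>x y. N (x + y) \<le> N x + N y)"

definition C2_strictly_convex_norm :: "(real^2 \<Rightarrow> real) \<Rightarrow> bool" where
  "C2_strictly_convex_norm N \<longleftrightarrow> is_norm N \<and>
     (\<exists>(D1 :: real^2 \<Rightarrow> ((real^2) \<Rightarrow>\<^sub>L real)) (D2 :: real^2 \<Rightarrow> ((real^2) \<Rightarrow>\<^sub>L ((real^2) \<Rightarrow>\<^sub>L real))).
        (\<forall>x. x \<noteq> 0 \<longrightarrow> (N has_derivative blinfun_apply (D1 x)) (at x)) \<and>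
        (\<forall>x. x \<noteq> 0 \<longrightarrow> (D1 has_derivative blinfun_apply (D2 x)) (at x)) \<and>
        continuous_on (UNIV - {0}) D2 \<and>
        (\<forall>x h. x \<noteq> 0 \<longrightarrow> (\<nexists>c. h = c *\<^sub>R x) \<longrightarrow> blinfun_apply (blinfun_apply (D2 x) h) h > 0))"

definition self_contracted :: "(real^2 \<Rightarrow> real) \<Rightarrow> real set \<Rightarrow> (real \<Rightarrow> real^2) \<Rightarrow> bool" where
  "self_contracted N I \<gamma> \<longleftrightarrow>
     (\<forall>a b. a \<le> b \<longrightarrow> {a..b} \<subseteq> I \<longrightarrow>
        (\<forall>s t. a \<le> s \<longrightarrow> s \<le> t \<longrightarrow> t \<le> b \<longrightarrow> N (\<gamma> t - \<gamma> b) \<le> N (\<gamma> s - \<gamma> b)))"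

definition curve_length :: "real set \<Rightarrow> (real \<Rightarrow> real^2) \<Rightarrow> ennreal" where
  "curve_length I \<gamma> = Sup {ennreal (\<Sum>i<m. dist (\<gamma> (t i)) (\<gamma> (t (Suc i)))) | t m.
      (\<forall>i\<le>m. t i \<in> I) \<and> (\<forall>i<m. t i < t (Suc i))}"

text \<open>Euclidean diameter, possibly infinite (0 for the empty set).\<close>
definition ediam :: "(real^2) set \<Rightarrow> ennreal" where
  "ediam S = Sup {ennreal (dist x y) | x y. x \<in> S \<and> y \<in> S}"

end

theory Submission
  imports Defs
begin

text \<open>
  Only finite self-contracted sequences \<open>x\<^sub>0, \<dots>, x\<^sub>m\<close> matter. Fix \<open>i\<close> and put
  \<open>y\<^sub>k = x\<^sub>k - x\<^sub>i\<close> for \<open>k > i\<close>. Self-contractedness says \<open>N (y\<^sub>k - y\<^sub>j) \<le> N y\<^sub>k\<close> for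
  \<open>j < k\<close>; by convexity, adding to \<open>y\<^sub>k\<close> a nonnegative combination of earlier \<open>y\<^sub>j\<close> does not
  decrease its norm. Peeling off the last vector of a nonnegative combination therefore shows that
  combinations of at most three of the \<open>y\<^sub>k\<close> cannot cancel, so by Caratheodory's theorem the
  convex hull of the directions of the \<open>y\<^sub>k\<close> stays a fixed distance away from 0. Its point
  nearest to 0 yields a unit vector \<open>d\<close> with \<open>d \<bullet> y\<^sub>k \<ge> \<kappa> |y\<^sub>k|\<close> for all \<open>k > i\<close>, and
  \<open>|y\<^sub>k|\<close> is at least a constant times \<open>|x\<^sub>i\<^sub>+\<^sub>1 - x\<^sub>i|\<close>. Replacing \<open>d\<close> by a nearby element \<open>f\<close>
  of a fixed finite net \<open>F\<close> of the circle, the potential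
  \<open>\<Sum>f\<in>F. min\<^sub>k\<^sub>\<ge>\<^sub>i f \<bullet> x\<^sub>k\<close> grows at step \<open>i\<close> by a constant times \<open>|x\<^sub>i\<^sub>+\<^sub>1 - x\<^sub>i|\<close>, while its
  total growth is at most \<open>card F\<close> times the diameter.
\<close>

section \<open>Comparison of the norm with the Euclidean norm\<close>

lemma is_norm_sum_le:
  assumes "is_norm N" "finite J" "\<And>j. j \<in> J \<Longrightarrow> w j \<ge> 0"
  shows "N (\<Sum>j\<in>J. w j *\<^sub>R y j) \<le> (\<Sum>j\<in>J. w j * N (y j))"
  using assms(2,3)
proof (induction J)
  case empty
  have "N 0 = 0" using assms(1) unfolding is_norm_def by blast
  then show ?case by simp
next
  case (insert k J)
  have "N (w k *\<^sub>R y k + (\<Sum>j\<in>J. w j *\<^sub>R y j)) \<le> N (w k *\<^sub>R y k) + N (\<Sum>j\<in>J. w j *\<^sub>R y j)"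
    using assms(1) unfolding is_norm_def by blast
  also have "N (w k *\<^sub>R y k) = w k * N (y k)"
    using assms(1) insert.prems by (simp add: is_norm_def)
  finally show ?case using insert by force
qed

lemma is_norm_equivalent:
  assumes "is_norm N"
  shows "\<exists>b>0. \<exists>B>0. \<forall>x. b * norm x \<le> N x \<and> N x \<le> B * norm x"
proof -
  have zero: "N x = 0 \<longleftrightarrow> x = 0" and scale: "N (c *\<^sub>R x) = \<bar>c\<bar> * N x"
    and tri: "N (x + y) \<le> N x + N y" for c x y
    using assms by (auto simp: is_norm_def)
  have neg: "N (- x) = N x" for x using scale[of "-1" x] by simp
  have pos: "N x \<ge> 0" for x
    using tri[of x "-x"] neg[of x] zero[of 0] by simp
  define B where "B = (\<Sum>i\<in>Basis. N i) + 1"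
  have B: "B > 0" unfolding B_def by (smt (verit) pos sum_nonneg)
  have upper: "N x \<le> B * norm x" for x
  proof -
    \<comment> \<open>The sign of each coordinate is moved into the vector, so that the weights are
      nonnegative as \<open>is_norm_sum_le\<close> demands.\<close>
    have "N x = N (\<Sum>i\<in>Basis. \<bar>x \<bullet> i\<bar> *\<^sub>R (sgn (x \<bullet> i) *\<^sub>R i))"
      by (simp add: euclidean_representation abs_mult_sgn)
    also have "\<dots> \<le> (\<Sum>i\<in>Basis. \<bar>x \<bullet> i\<bar> * N (sgn (x \<bullet> i) *\<^sub>R i))"
      by (intro is_norm_sum_le assms) auto
    also have "\<dots> \<le> (\<Sum>i\<in>Basis. norm x * N i)"
    proof (intro sum_mono mult_mono)
      show "N (sgn (x \<bullet> i) *\<^sub>R i) \<le> N i" for i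
        by (simp add: scale sgn_real_def pos)
    qed (auto simp: Basis_le_norm pos)
    also have "\<dots> \<le> B * norm x"
      by (simp add: B_def sum_distrib_left algebra_simps)
    finally show ?thesis .
  qed
  \<comment> \<open>The reverse triangle inequality and the upper bound make \<open>N\<close>
    Lipschitz, so it attains its minimum on the compact unit circle; that minimum is the lower
    constant.\<close>
  have "\<bar>N x - N y\<bar> \<le> B * norm (x - y)" for x y
    using tri[of "x - y" y] tri[of "y - x" x] upper[of "x - y"] neg[of "x - y"] by simp
  then have "B-lipschitz_on UNIV N"
    using B by (intro lipschitz_onI) (auto simp: dist_norm)
  then have "continuous_on (sphere 0 1) N"
    using lipschitz_on_continuous_on continuous_on_subset by blast
  then obtain z where z: "z \<in> sphere 0 1" "\<And>x. x \<in> sphere 0 1 \<Longrightarrow> N z \<le> N x"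
    using continuous_attains_inf[of "sphere (0::real^2) 1" N] by (auto simp del: mem_sphere)
  have "N z * norm x \<le> N x" for x
  proof (cases "x = 0")
    case False
    have "N z \<le> N ((1 / norm x) *\<^sub>R x)" using False by (intro z(2)) simp
    then show ?thesis using False by (simp add: scale field_simps)
  qed (simp add: pos)
  moreover have "N z > 0" using z(1) pos[of z] zero[of z] by force
  ultimately show ?thesis using upper B by blast
qed

section \<open>Nonnegative combinations and a uniform direction\<close>

text \<open>With \<open>s\<close> the sum of the weights, \<open>(r + s) *\<^sub>R v\<close> is the
  combination plus the vectors \<open>w j *\<^sub>R (v - y j)\<close>, whose norms add up to at most
  \<open>s * N v\<close>.\<close>

lemma is_norm_le_add_cone:
  assumes "is_norm N" "finite J" "\<And>j. j \<in> J \<Longrightarrow> w j \<ge> 0"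
    and "\<And>j. j \<in> J \<Longrightarrow> N (v - y j) \<le> N v" and "r \<ge> 0"
  shows "r * N v \<le> N (r *\<^sub>R v + (\<Sum>j\<in>J. w j *\<^sub>R y j))"
proof -
  let ?s = "\<Sum>j\<in>J. w j" and ?z = "r *\<^sub>R v + (\<Sum>j\<in>J. w j *\<^sub>R y j)"
  have "?s \<ge> 0" using assms(3) by (simp add: sum_nonneg)
  then have "(r + ?s) * N v = N ((r + ?s) *\<^sub>R v)"
    using assms(1,5) by (simp add: is_norm_def)
  also have "(r + ?s) *\<^sub>R v = ?z + (\<Sum>j\<in>J. w j *\<^sub>R (v - y j))"
    by (simp add: scaleR_left.sum algebra_simps sum_subtractf)
  also have "N \<dots> \<le> N ?z + N (\<Sum>j\<in>J. w j *\<^sub>R (v - y j))"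
    using assms(1) by (simp add: is_norm_def)
  also have "N (\<Sum>j\<in>J. w j *\<^sub>R (v - y j)) \<le> (\<Sum>j\<in>J. w j * N (v - y j))"
    using assms by (intro is_norm_sum_le)
  also have "\<dots> \<le> (\<Sum>j\<in>J. w j * N v)"
    using assms by (intro sum_mono mult_left_mono)
  finally show ?thesis by (simp add: sum_distrib_right[symmetric] distrib_right)
qed

text \<open>Quantitative non-cancellation. Removing the term of largest index at most doubles the
  norm of the combination, and that term itself costs the norm once more: \<open>c\<close> becomes
  \<open>2 * c + 1\<close>.\<close>

lemma sum_is_norm_le_is_norm_sum:
  fixes J :: "nat set"
  assumes "is_norm N" "finite J" "\<And>j. j \<in> J \<Longrightarrow> w j \<ge> 0"
    and "\<And>j k. j \<in> J \<Longrightarrow> k \<in> J \<Longrightarrow> j < k \<Longrightarrow> N (y k - y j) \<le> N (y k)"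
  shows "(\<Sum>j\<in>J. w j * N (y j)) \<le> (2 ^ card J - 1) * N (\<Sum>j\<in>J. w j *\<^sub>R y j)"
  using assms(2-)
proof (induction J rule: finite_linorder_max_induct)
  case empty
  then show ?case by simp
next
  case (insert k J)
  let ?z = "\<Sum>j\<in>J. w j *\<^sub>R y j" and ?c = "2 ^ card J - 1 :: real"
  have [simp]: "k \<notin> J" using insert by blast
  have last: "w k * N (y k) \<le> N (w k *\<^sub>R y k + ?z)"
    using insert by (intro is_norm_le_add_cone assms(1)) auto
  have "N (- (w k *\<^sub>R y k)) = w k * N (y k)"
    using assms(1) insert.prems(1)[of k] unfolding is_norm_def
    by (metis abs_minus_cancel abs_of_nonneg insertI1 scaleR_minus_left)
  moreover have "N ((w k *\<^sub>R y k + ?z) + - (w k *\<^sub>R y k)) \<le> N (w k *\<^sub>R y k + ?z) + N (- (w k *\<^sub>R y k))"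
    using assms(1) unfolding is_norm_def by blast
  ultimately have "N ?z \<le> 2 * N (w k *\<^sub>R y k + ?z)" using last by simp
  then have "?c * N ?z \<le> ?c * (2 * N (w k *\<^sub>R y k + ?z))"
    by (intro mult_left_mono) auto
  moreover have "(\<Sum>j\<in>J. w j * N (y j)) \<le> ?c * N ?z"
    using insert by simp
  ultimately show ?case using last insert.hyps by (simp add: algebra_simps)
qed

text \<open>The constant does not depend on \<open>card J\<close>: Caratheodory in the plane leaves
  at most three vectors, and 7 is \<open>2 ^ 3 - 1\<close>.\<close>

lemma ex_uniform_direction:
  fixes y :: "nat \<Rightarrow> real^2"
  assumes N: "is_norm N" and b: "b > 0" "\<And>x. b * norm x \<le> N x"
    and B: "B > 0" "\<And>x. N x \<le> B * norm x"
    and J: "finite J" "J \<noteq> {}" "\<And>j. j \<in> J \<Longrightarrow> y j \<noteq> 0"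
    and chain: "\<And>j k. j \<in> J \<Longrightarrow> k \<in> J \<Longrightarrow> j < k \<Longrightarrow> N (y k - y j) \<le> N (y k)"
  shows "\<exists>d. norm d = 1 \<and> (\<forall>j\<in>J. b / (7 * B) * norm (y j) \<le> d \<bullet> y j)"
proof -
  define H where "H = convex hull ((\<lambda>j. sgn (y j)) ` J)"
  have H: "closed H" "convex H" "H \<noteq> {}"
    using J by (auto simp: H_def finite_imp_compact_convex_hull compact_imp_closed)
  define e where "e = closest_point H 0"
  have "e \<in> H" unfolding e_def by (rule closest_point_in_set[OF H(1,3)])
  then obtain S where S: "finite S" "S \<subseteq> (\<lambda>j. sgn (y j)) ` J" "card S \<le> 3" "e \<in> convex hull S"
    unfolding H_def by (subst (asm) caratheodory) (auto simp: eval_nat_numeral)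
  \<comment> \<open>Back from directions to indices, since the chain hypothesis refers to their
    order.\<close>
  obtain K where K: "K \<subseteq> J" "inj_on (\<lambda>j. sgn (y j)) K" "S = (\<lambda>j. sgn (y j)) ` K"
    using S(2) unfolding subset_image_inj by blast
  have "finite K" using K(1) J(1) finite_subset by blast
  have "card K \<le> 3" using S(3) K by (simp add: card_image)
  obtain u where u: "\<And>x. x \<in> S \<Longrightarrow> u x \<ge> 0" "sum u S = 1" "(\<Sum>x\<in>S. u x *\<^sub>R x) = e"
    using S(4) unfolding convex_hull_finite[OF S(1)] by auto
  \<comment> \<open>Dividing by the lengths turns a convex combination of directions into a
    nonnegative combination of the \<open>y j\<close> with \<open>w j * norm (y j)\<close> summing
    to 1.\<close>
  define w where "w = (\<lambda>j. u (sgn (y j)) / norm (y j))"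
  have w: "w j \<ge> 0" if "j \<in> K" for j using that u(1) K by (auto simp: w_def)
  have e: "e = (\<Sum>j\<in>K. w j *\<^sub>R y j)"
    unfolding u(3)[symmetric] K(3) sum.reindex[OF K(2)]
    by (simp add: w_def sgn_div_norm divide_inverse)
  have "b = (\<Sum>j\<in>K. b * u (sgn (y j)))"
    using u(2) by (simp add: K(3) sum.reindex[OF K(2)] sum_distrib_left[symmetric])
  also have "\<dots> = (\<Sum>j\<in>K. w j * (b * norm (y j)))"
    using J(3) K(1) by (intro sum.cong) (auto simp: w_def)
  also have "\<dots> \<le> (\<Sum>j\<in>K. w j * N (y j))"
    using w b by (intro sum_mono mult_left_mono)
  also have "\<dots> \<le> (2 ^ card K - 1) * N e"
    unfolding e using \<open>finite K\<close> K(1) w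
    by (intro sum_is_norm_le_is_norm_sum N) (auto intro!: chain)
  also have "\<dots> \<le> 7 * (B * norm e)"
  proof (rule mult_mono)
    have "(2::real) ^ card K \<le> 2 ^ 3" using \<open>card K \<le> 3\<close> by (intro power_increasing) auto
    then show "(2::real) ^ card K - 1 \<le> 7" by simp
    show "0 \<le> N e" using b(2)[of e] b(1) by (smt (verit) mult_nonneg_nonneg norm_ge_zero)
  qed (use B in auto)
  finally have e_ge: "b / (7 * B) \<le> norm e" using B(1) by (simp add: field_simps)
  then have "e \<noteq> 0" using b(1) B(1) by (auto simp: field_simps)
  have "b / (7 * B) * norm (y j) \<le> sgn e \<bullet> y j" if "j \<in> J" for j
  proof -
    have "sgn (y j) \<in> H" using that by (auto simp: H_def intro: hull_inc)
    \<comment> \<open>Variational inequality for the nearest point: the inner product of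
      \<open>e\<close> with each direction is at least the square of \<open>norm e\<close>.\<close>
    then have "(0 - e) \<bullet> (sgn (y j) - e) \<le> 0"
      unfolding e_def using closest_point_dot[OF H(2,1)] by blast
    then have "norm e * norm e * norm (y j) \<le> e \<bullet> y j"
      using J(3)[OF that]
      by (simp add: inner_diff_right sgn_div_norm field_simps dot_square_norm power2_eq_square)
    then have "norm e * norm (y j) \<le> sgn e \<bullet> y j"
      using \<open>e \<noteq> 0\<close> by (simp add: sgn_div_norm field_simps)
    then show ?thesis using e_ge by (smt (verit) mult_right_mono norm_ge_zero)
  qed
  then show ?thesis using \<open>e \<noteq> 0\<close> by (intro exI[of _ "sgn e"]) (simp add: norm_sgn)
qed

section \<open>Length bound for finite sequences\<close>

lemma self_contracted_sequence_length_le: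
  assumes N: "is_norm N"
  shows "\<exists>C>0. \<forall>m (x :: nat \<Rightarrow> real^2) D.
    (\<forall>i j k. i \<le> j \<longrightarrow> j \<le> k \<longrightarrow> k \<le> m \<longrightarrow> N (x j - x k) \<le> N (x i - x k)) \<longrightarrow>
    (\<forall>k\<le>m. dist (x m) (x k) \<le> D) \<longrightarrow>
    (\<Sum>i<m. dist (x i) (x (Suc i))) \<le> C * D"
proof -
  obtain b B where b: "b > 0" "\<And>x. b * norm x \<le> N x" and B: "B > 0" "\<And>x. N x \<le> B * norm x"
    using is_norm_equivalent[OF N] by blast
  have sym: "N (p - q) = N (q - p)" for p q
    using N unfolding is_norm_def
    by (metis abs_minus_cancel abs_one minus_diff_eq mult_1 scaleR_minus1_left)
  define \<kappa> where "\<kappa> = b / (7 * B)"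
  have "\<kappa> > 0" using b B by (simp add: \<kappa>_def)
  then obtain F :: "(real^2) set"
    where F: "finite F" "F \<subseteq> sphere 0 1" "sphere 0 1 \<subseteq> (\<Union>f\<in>F. ball f (\<kappa> / 2))"
    using compactE_image[OF compact_sphere[of "0::real^2" 1], of "sphere 0 1" "\<lambda>f. ball f (\<kappa> / 2)"]
    by (metis (no_types, lifting) UN_iff centre_in_ball half_gt_zero open_ball subsetI)
  \<comment> \<open>The first factor is what remains of \<kappa> after passing to the net; the
    second comes from \<open>half\<close> below.\<close>
  define c where "c = \<kappa> / 2 * (b / (2 * B))"
  have "c > 0" using \<open>\<kappa> > 0\<close> b B by (simp add: c_def)
  show ?thesis
  proof (intro exI[of _ "(card F + 1) / c"] conjI allI impI)
    show "0 < (card F + 1) / c" using \<open>c > 0\<close> by simp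
  next
    fix m D and x :: "nat \<Rightarrow> real^2"
    assume sc: "\<forall>i j k. i \<le> j \<longrightarrow> j \<le> k \<longrightarrow> k \<le> m \<longrightarrow> N (x j - x k) \<le> N (x i - x k)"
    assume D: "\<forall>k\<le>m. dist (x m) (x k) \<le> D"
    \<comment> \<open>As \<open>i\<close> grows the minimum runs over fewer points, so
      \<open>h f\<close> increases; at \<open>m\<close> only \<open>x m\<close> is left.\<close>
    define h where "h = (\<lambda>f i. Min ((\<lambda>k. f \<bullet> x k) ` {i..m}))"
    have h_le: "h f i \<le> f \<bullet> x k" if "i \<le> k" "k \<le> m" for f i k
      unfolding h_def using that by (intro Min_le) auto
    have h_ge: "a \<le> h f i" if "i \<le> m" "\<And>k. i \<le> k \<Longrightarrow> k \<le> m \<Longrightarrow> a \<le> f \<bullet> x k" for f i a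
      unfolding h_def using that by (intro Min.boundedI) auto
    have mono: "h f i \<le> h f (Suc i)" if "i < m" for f i
      using that by (intro h_ge h_le) auto
    have step: "c * dist (x i) (x (Suc i)) \<le> (\<Sum>f\<in>F. h f (Suc i) - h f i)" if "i < m" for i
    proof (cases "x (Suc i) = x i")
      case True
      then show ?thesis using mono[OF that] by (simp add: sum_nonneg)
    next
      case False
      define y where "y = (\<lambda>k. x k - x i)"
      have half: "b / (2 * B) * dist (x i) (x (Suc i)) \<le> norm (y k)" if "Suc i \<le> k" "k \<le> m" for k
      proof -
        \<comment> \<open>Detour through \<open>x k\<close>: by self-contractedness both legs are at
          most \<open>N (y k)\<close>.\<close>
        have "N (x (Suc i) - x i) \<le> N (x (Suc i) - x k) + N (x k - x i)"
          using N unfolding is_norm_def by (metis diff_add_cancel add_diff_eq)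
        also have "N (x (Suc i) - x k) \<le> N (x i - x k)"
          using sc that by simp
        finally have "N (x (Suc i) - x i) \<le> 2 * N (y k)"
          by (simp add: y_def sym[of "x i"])
        then have "b * norm (x (Suc i) - x i) \<le> 2 * (B * norm (y k))"
          using b(2)[of "x (Suc i) - x i"] B(2)[of "y k"] by linarith
        then show ?thesis using B(1) by (simp add: dist_norm norm_minus_commute field_simps)
      qed
      have "\<exists>d. norm d = 1 \<and> (\<forall>k\<in>{Suc i..m}. b / (7 * B) * norm (y k) \<le> d \<bullet> y k)"
      proof (rule ex_uniform_direction[OF N b B])
        show "{Suc i..m} \<noteq> {}" using that by simp
        have "b / (2 * B) * dist (x i) (x (Suc i)) > 0" using False b B by simp
        then show "y k \<noteq> 0" if "k \<in> {Suc i..m}" for k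
          using half[of k] that by auto
        show "N (y k - y j) \<le> N (y k)" if "j \<in> {Suc i..m}" "k \<in> {Suc i..m}" "j < k" for j k
          using sc[rule_format, of i j k] that by (simp add: y_def sym[of "x k"])
      qed simp
      then obtain d where d: "norm d = 1" "\<And>k. Suc i \<le> k \<Longrightarrow> k \<le> m \<Longrightarrow> \<kappa> * norm (y k) \<le> d \<bullet> y k"
        by (auto simp: \<kappa>_def)
      obtain f where f: "f \<in> F" "dist f d < \<kappa> / 2" using F(3) d(1) by force
      have "f \<bullet> x i + c * dist (x i) (x (Suc i)) \<le> f \<bullet> x k" if k: "Suc i \<le> k" "k \<le> m" for k
      proof -
        \<comment> \<open>Replacing \<open>d\<close> by \<open>f\<close> loses at most half of
          \<kappa>.\<close>
        have "(d - f) \<bullet> y k \<le> \<kappa> / 2 * norm (y k)"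
          using f(2) norm_cauchy_schwarz[of "d - f" "y k"]
          by (smt (verit) dist_norm mult_right_mono norm_ge_zero norm_minus_commute)
        then have "\<kappa> / 2 * norm (y k) \<le> f \<bullet> y k"
          using d(2)[OF k] by (simp add: inner_diff_left)
        moreover have "c * dist (x i) (x (Suc i)) \<le> \<kappa> / 2 * norm (y k)"
          using mult_left_mono[OF half[OF k], of "\<kappa> / 2"] \<open>\<kappa> > 0\<close> by (simp add: c_def mult.assoc)
        ultimately show ?thesis by (simp add: y_def inner_diff_right)
      qed
      then have "f \<bullet> x i + c * dist (x i) (x (Suc i)) \<le> h f (Suc i)"
        using that by (intro h_ge) auto
      then have "c * dist (x i) (x (Suc i)) \<le> h f (Suc i) - h f i"
        using h_le[of i i f] that by simp
      also have "\<dots> \<le> (\<Sum>f\<in>F. h f (Suc i) - h f i)"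
        using mono[OF that] F(1) f(1) by (intro member_le_sum) auto
      finally show ?thesis .
    qed
    have total: "h f m - h f 0 \<le> D" if "f \<in> F" for f
    proof -
      have "f \<bullet> x m - D \<le> h f 0"
      proof (rule h_ge)
        fix k assume "k \<le> m"
        have "f \<bullet> (x m - x k) \<le> norm f * norm (x m - x k)" by (rule norm_cauchy_schwarz)
        also have "\<dots> \<le> D" using F(2) that D \<open>k \<le> m\<close> by (auto simp: dist_norm)
        finally show "f \<bullet> x m - D \<le> f \<bullet> x k" by (simp add: inner_diff_right)
      qed simp
      then show ?thesis using h_le[of m m f] by simp
    qed
    have "D \<ge> 0" using D[rule_format, of m] by simp
    have "c * (\<Sum>i<m. dist (x i) (x (Suc i))) \<le> (\<Sum>i<m. \<Sum>f\<in>F. h f (Suc i) - h f i)"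
      unfolding sum_distrib_left using step by (intro sum_mono) auto
    also have "\<dots> = (\<Sum>f\<in>F. h f m - h f 0)"
      by (subst sum.swap) (simp add: sum_lessThan_telescope)
    also have "\<dots> \<le> (\<Sum>f\<in>F. D)" by (intro sum_mono total)
    also have "\<dots> \<le> (card F + 1) * D" using \<open>D \<ge> 0\<close> by (simp add: algebra_simps)
    finally show "(\<Sum>i<m. dist (x i) (x (Suc i))) \<le> (card F + 1) / c * D"
      using \<open>c > 0\<close> by (simp add: field_simps)
  qed
qed

section \<open>From sequences to curves\<close>

lemma ediam_bounded:
  assumes "bounded S"
  shows "ediam S < \<infinity>"
proof -
  have "ediam S \<le> ennreal (diameter S)"
    unfolding ediam_def using assms
    by (intro Sup_least) (auto intro!: ennreal_leI diameter_bounded_bound)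
  then show ?thesis using le_less_trans by fastforce
qed

theorem theorem1p1:
  fixes N :: "real^2 \<Rightarrow> real"
  assumes "C2_strictly_convex_norm N"
  shows "\<exists>C>0. (\<forall>I \<gamma>. is_interval I \<longrightarrow> self_contracted N I \<gamma> \<longrightarrow>
              curve_length I \<gamma> \<le> ennreal C * ediam (closure (convex hull (\<gamma> ` I))))
            \<and> (\<forall>I \<gamma>. is_interval I \<longrightarrow> self_contracted N I \<gamma> \<longrightarrow> bounded (\<gamma> ` I) \<longrightarrow>
              curve_length I \<gamma> < \<infinity>)"
proof -
  have "is_norm N" using assms by (simp add: C2_strictly_convex_norm_def)
  then obtain C where "C > 0" and C: "\<And>m (x :: nat \<Rightarrow> real^2) D.
      (\<And>i j k. i \<le> j \<Longrightarrow> j \<le> k \<Longrightarrow> k \<le> m \<Longrightarrow> N (x j - x k) \<le> N (x i - x k)) \<Longrightarrow>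
      (\<And>k. k \<le> m \<Longrightarrow> dist (x m) (x k) \<le> D) \<Longrightarrow>
      (\<Sum>i<m. dist (x i) (x (Suc i))) \<le> C * D"
    using self_contracted_sequence_length_le by meson
  have main: "curve_length I \<gamma> \<le> ennreal C * ediam (closure (convex hull (\<gamma> ` I)))"
    if I: "is_interval I" and sc: "self_contracted N I \<gamma>" for I \<gamma>
  proof (cases "ediam (closure (convex hull (\<gamma> ` I)))")
    case top
    then show ?thesis using \<open>C > 0\<close> by (simp add: ennreal_mult_top)
  next
    case (real D)
    have D: "dist (\<gamma> s) (\<gamma> t) \<le> D" if "s \<in> I" "t \<in> I" for s t
    proof -
      have "\<gamma> ` I \<subseteq> closure (convex hull (\<gamma> ` I))"
        using closure_subset hull_subset by (metis order_trans)
      then have "ennreal (dist (\<gamma> s) (\<gamma> t)) \<le> ediam (closure (convex hull (\<gamma> ` I)))"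
        unfolding ediam_def using that by (intro Sup_upper) blast
      then show ?thesis using real by simp
    qed
    have "ennreal (\<Sum>i<m. dist (\<gamma> (t i)) (\<gamma> (t (Suc i)))) \<le> ennreal (C * D)"
      if t: "\<forall>i\<le>m. t i \<in> I" "\<forall>i<m. t i < t (Suc i)" for t m
    proof (intro ennreal_leI C)
      show "dist (\<gamma> (t m)) (\<gamma> (t k)) \<le> D" if "k \<le> m" for k
        using t(1) that by (intro D) auto
      fix i j k assume ijk: "i \<le> j" "j \<le> k" "k \<le> m"
      \<comment> \<open>The values of \<open>t\<close> beyond \<open>m\<close> are arbitrary, hence
        the bound on \<open>q\<close>.\<close>
      have mono: "t p \<le> t q" if "p \<le> q" "q \<le> m" for p q
        using that
      proof (induction q rule: dec_induct)
        case (step q)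
        then show ?case using t(2)[rule_format, of q] by simp
      qed simp
      have "{t i..t k} \<subseteq> I"
        using I t(1) ijk by (meson atLeastAtMost_iff is_interval_1 le_trans subsetI)
      then show "N (\<gamma> (t j) - \<gamma> (t k)) \<le> N (\<gamma> (t i) - \<gamma> (t k))"
        using sc ijk mono unfolding self_contracted_def by (meson le_trans order_refl)
    qed
    then show ?thesis
      unfolding curve_length_def using real \<open>C > 0\<close>
      by (intro Sup_least) (auto simp: ennreal_mult)
  qed
  moreover have "curve_length I \<gamma> < \<infinity>"
    if "is_interval I" "self_contracted N I \<gamma>" "bounded (\<gamma> ` I)" for I \<gamma>
  proof -
    have "ediam (closure (convex hull (\<gamma> ` I))) < \<infinity>"
      using that(3) by (intro ediam_bounded bounded_closure bounded_convex_hull)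
    then have "ennreal C * ediam (closure (convex hull (\<gamma> ` I))) < \<infinity>"
      by (simp add: ennreal_mult_less_top)
    then show ?thesis using main[OF that(1,2)] by (rule le_less_trans[rotated])
  qed
  ultimately show ?thesis using \<open>C > 0\<close> by blast
qed

end
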